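(* Let $n\in\mathbb{N}$. Any Boolean function $f:\{0,1\}^n\to\{\pm1\}$ in $n$ variables can be realized by a perceptron with polynomial kernel of degree $n$. For every $d\in\mathbb{N}$ with $d<n$ there exists a Boolean function $f:\{0,1\}^n\to\{\pm1\}$ that cannot be realized by a perceptron with polynomial kernel of degree $d$.
   Context: $\mathbb{N}=\{1,2,3,\ldots\}$. Let $m=2^n$ and $\{x_1,\ldots,x_m\}=\{0,1\}^n\subset\mathbb{R}^n$. A Boolean function $f:\{0,1\}^n\to\{\pm1\}$ is identified with the labels $y_i=f(x_i)\in\{\pm1\}$, $i=1,\ldots,m$. A perceptron with polynomial kernel of degree $d\in\mathbb{N}$ (kernel $k(v,w)=\langle v,w\rangle^d$, with $\langle\cdot,\cdot\rangle$ the canonical scalar product on $\mathbb{R}^n$) has a transfer function $f_p:\mathbb{R}^n\to\{\pm1\}$ of the form $$f_p(x)=\sigma\left(\sum_{i=1}^m\alpha_iy_i\langle x_i,x\rangle^d+b\right),\qquad \sigma(z)=\begin{cases}1,&z\ge0\\-1,&z<0,\end{cases}$$ with real parameters $\alpha_1,\ldots,\alpha_m$ and $b$. The perceptron realizes $f$ if $f_p$ coincides with $f$ on $\{0,1\}^n$, i.e. $f_p(x_j)=y_j$ for all $j=1,\ldots,m$. *)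

theory Defs
  imports "HOL-Analysis.Analysis"
begin

definition cube :: "(real ^ 'n) set" where
  "cube = {x. \<forall>i. x $ i \<in> {0, 1}}"

text \<open>Labels take values in \<open>{-1, 1}\<close> inside the reals; only the values of \<open>f\<close> on
  the cube are constrained, and only these enter the definitions below.\<close>

definition boolean_function :: "(real ^ 'n \<Rightarrow> real) \<Rightarrow> bool" where
  "boolean_function f \<longleftrightarrow> f \<in> cube \<rightarrow> {-1, 1}"

definition threshold :: "real \<Rightarrow> real" where
  "threshold z = (if z \<ge> 0 then 1 else -1)"

definition poly_kernel :: "nat \<Rightarrow> real ^ 'n \<Rightarrow> real ^ 'n \<Rightarrow> real" where
  "poly_kernel d v w = (v \<bullet> w) ^ d"

text \<open>The \<open>2^n\<close> training points are the points of the cube, so the coefficients \<open>\<alpha>\<close> and the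
  labels \<open>f\<close> are indexed by these points instead of by an enumeration of them.\<close>

definition transfer_function ::
  "nat \<Rightarrow> (real ^ 'n \<Rightarrow> real) \<Rightarrow> (real ^ 'n \<Rightarrow> real) \<Rightarrow> real \<Rightarrow> real ^ 'n \<Rightarrow> real" where
  "transfer_function d f \<alpha> b x =
     threshold ((\<Sum>v\<in>cube. \<alpha> v * f v * poly_kernel d v x) + b)"

definition realizable :: "nat \<Rightarrow> (real ^ 'n \<Rightarrow> real) \<Rightarrow> bool" where
  "realizable d f \<longleftrightarrow> (\<exists>\<alpha> b. \<forall>x\<in>cube. transfer_function d f \<alpha> b x = f x)"

text \<open>The sum in \<^const>\<open>transfer_function\<close> is a genuine finite sum, over \<open>2^n\<close> points.\<close>

lemma
  shows finite_cube: "finite (cube :: (real ^ 'n) set)"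
    and card_cube: "card (cube :: (real ^ 'n) set) = 2 ^ CARD('n)"
proof -
  have bij: "bij_betw (\<lambda>S. \<chi> i. if i \<in> S then 1 else 0) (UNIV :: 'n set set)
      (cube :: (real ^ 'n) set)"
    by (rule bij_betw_byWitness[where f' = "\<lambda>x. {i. x $ i = 1}"])
       (auto simp: cube_def vec_eq_iff)
  then show "finite (cube :: (real ^ 'n) set)"
    using bij_betw_finite finite by blast
  show "card (cube :: (real ^ 'n) set) = 2 ^ CARD('n)"
    using bij_betw_same_card[OF bij] card_Pow[of "UNIV :: 'n set"] by simp
qed

end

theory Submission
  imports Defs "HOL-Combinatorics.Stirling"
begin

text \<open>
  Points of the cube are subsets of the index set, and the kernel of \<open>R\<close> and \<open>S\<close> becomes
  \<open>\<bar>R \<inter> S\<bar> ^ d\<close>. Everything rests on one computation (\<open>alternating_sum_card_power\<close>): in the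
  sum of \<open>\<bar>S \<inter> B\<bar> ^ d\<close> over \<open>S \<subseteq> A\<close> with signs \<open>(-1) ^ \<bar>S\<bar>\<close>, everything cancels unless
  \<open>A \<subseteq> B\<close>, and then, up to sign, the sum counts the surjections of a \<open>d\<close>-element set onto \<open>A\<close>.

  If \<open>d\<close> is at least the number of variables, this count is nonzero for all nonempty \<open>A\<close>, so
  all nonconstant monomials \<open>B \<mapsto> [A \<subseteq> B]\<close> are combinations of kernel functions. By Moebius
  inversion over subsets, the monomials span all functions on the cube, and only the constant
  monomial is left for the bias to supply. So even the real values of \<open>f\<close> can be interpolated
  exactly, not just its sign.

  If \<open>d\<close> is smaller than the number of variables, the same count, taken for the full index set,
  is zero. Hence every combination of kernel functions and a constant is orthogonal to the
  parity function. A function having the sign of the parity at every point has nonnegative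
  products with it, so orthogonality forces it to vanish identically; but then its threshold
  is \<open>1\<close> everywhere, contrary to the value of the parity on singletons.
\<close>

section \<open>Alternating sums of powers of intersection sizes\<close>

lemma sum_Pow_containing:
  fixes F :: "'a set \<Rightarrow> 'b::ab_group_add"
  assumes "finite A" "i \<in> A"
  shows "(\<Sum>S\<in>Pow A. if i \<in> S then F S else 0) = sum F (Pow A) - sum F (Pow (A - {i}))"
proof -
  have "sum F (Pow (A - {i})) = (\<Sum>S\<in>Pow A. if i \<notin> S then F S else 0)"
    using assms by (simp add: sum.If_cases, intro sum.cong) auto
  then have "(\<Sum>S\<in>Pow A. if i \<in> S then F S else 0) + sum F (Pow (A - {i})) =
      (\<Sum>S\<in>Pow A. (if i \<in> S then F S else 0) + (if i \<notin> S then F S else 0))"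
    by (simp add: sum.distrib)
  also have "\<dots> = sum F (Pow A)"
    by (intro sum.cong) auto
  finally show ?thesis
    by (simp add: algebra_simps)
qed

text \<open>
  For \<open>A \<subseteq> B\<close> the right-hand side is, up to sign, the number of surjections onto \<open>A\<close>. The
  proof is by induction on \<open>d\<close>: splitting off one factor \<open>\<bar>S \<inter> B\<bar> = (\<Sum>i\<in>A \<inter> B. [i \<in> S])\<close>
  expresses the sum for \<open>d + 1\<close> by those for \<open>d\<close> over \<open>A\<close> and over \<open>A - {i}\<close>, which is the
  recurrence of the Stirling numbers of the second kind.
\<close>

lemma alternating_sum_card_power:
  assumes "finite A"
  shows "(\<Sum>S\<in>Pow A. (-1) ^ card S * real (card (S \<inter> B)) ^ d) =
    (if A \<subseteq> B then (-1) ^ card A * (fact (card A) * real (Stirling d (card A))) else 0)"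
  using assms
proof (induction d arbitrary: A)
  case 0
  show ?case
  proof (cases "A = {}")
    case False
    have "(\<Sum>S\<in>Pow A. (-1) ^ card S) = (\<Prod>x\<in>A. 1 - (1::real))"
      using prod_diff_conv_sum[OF \<open>finite A\<close>, of "\<lambda>_. 1::real" "\<lambda>_. 1"] by simp
    also have "\<dots> = 0"
      using False \<open>finite A\<close> by (simp add: card_gt_0_iff)
    finally have "(\<Sum>S\<in>Pow A. (-1) ^ card S) = (0::real)" .
    moreover obtain k where "card A = Suc k"
      using False \<open>finite A\<close> by (cases "card A") auto
    ultimately show ?thesis
      by simp
  qed simp
next
  case (Suc d)
  let ?D = "\<lambda>A. \<Sum>S\<in>Pow A. (-1) ^ card S * real (card (S \<inter> B)) ^ d"
  have card_eq: "real (card (S \<inter> B)) = (\<Sum>i\<in>A \<inter> B. if i \<in> S then 1 else 0)" if "S \<subseteq> A" for S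
  proof -
    have "S \<inter> B = A \<inter> B \<inter> S"
      using that by blast
    then show ?thesis
      using \<open>finite A\<close> by (simp add: sum.If_cases)
  qed
  have "(\<Sum>S\<in>Pow A. (-1) ^ card S * real (card (S \<inter> B)) ^ Suc d) =
      (\<Sum>S\<in>Pow A. \<Sum>i\<in>A \<inter> B. if i \<in> S then (-1) ^ card S * real (card (S \<inter> B)) ^ d else 0)"
  proof (intro sum.cong refl)
    fix S
    assume "S \<in> Pow A"
    let ?t = "(-1) ^ card S * real (card (S \<inter> B)) ^ d"
    have "(-1) ^ card S * real (card (S \<inter> B)) ^ Suc d = ?t * real (card (S \<inter> B))"
      by simp
    also have "\<dots> = ?t * (\<Sum>i\<in>A \<inter> B. if i \<in> S then 1 else 0)"
      using card_eq \<open>S \<in> Pow A\<close> by simp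
    also have "\<dots> = (\<Sum>i\<in>A \<inter> B. if i \<in> S then ?t else 0)"
      by (simp add: sum_distrib_left if_distrib cong: if_cong)
    finally show "(-1) ^ card S * real (card (S \<inter> B)) ^ Suc d =
        (\<Sum>i\<in>A \<inter> B. if i \<in> S then ?t else 0)" .
  qed
  also have "\<dots> = (\<Sum>i\<in>A \<inter> B. ?D A - ?D (A - {i}))"
    using \<open>finite A\<close> by (subst sum.swap) (intro sum.cong refl sum_Pow_containing, auto)
  also have "\<dots> = (if A \<subseteq> B then (-1) ^ card A * (fact (card A) * real (Stirling (Suc d) (card A))) else 0)"
  proof (cases "A \<subseteq> B")
    case False
    then have "\<not> A - {i} \<subseteq> B" if "i \<in> A \<inter> B" for i
      using that by blast
    then show ?thesis
      using False Suc.IH \<open>finite A\<close> by simp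
  next
    case True
    then have sub: "A - {i} \<subseteq> B" for i
      by blast
    show ?thesis
    proof (cases "card A")
      case 0
      then show ?thesis
        using \<open>finite A\<close> by simp
    next
      case (Suc k)
      have "?D A - ?D (A - {i}) =
          (-1) ^ Suc k * (fact (Suc k) * real (Stirling d (Suc k))) -
          (-1) ^ k * (fact k * real (Stirling d k))" if "i \<in> A" for i
        using Suc.IH \<open>finite A\<close> True sub that Suc by simp
      then have "(\<Sum>i\<in>A \<inter> B. ?D A - ?D (A - {i})) = real (Suc k) *
          ((-1) ^ Suc k * (fact (Suc k) * real (Stirling d (Suc k))) -
           (-1) ^ k * (fact k * real (Stirling d k)))"
        using True Suc by (simp add: Int_absorb2)
      also have "\<dots> = (-1) ^ Suc k * (fact (Suc k) * real (Stirling (Suc d) (Suc k)))"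
        by (simp add: algebra_simps)
      finally show ?thesis
        using True Suc by simp
    qed
  qed
  finally show ?case .
qed

lemma Stirling_pos:
  assumes "0 < k" "k \<le> n"
  shows "0 < Stirling n k"
  using assms
proof (induction n k rule: Stirling.induct)
  case (4 n k)
  then show ?case
    by (cases "k = n") auto
qed auto

section \<open>Kernel combinations as functions of subsets\<close>

text \<open>
  The alternating sums turn the kernel functions of the subsets of \<open>T\<close> into a multiple of the
  monomial of \<open>T\<close>; the coefficients of \<open>g\<close> in the monomials are found by inclusion-exclusion.
  The condition on \<open>g {}\<close> is necessary for \<open>d > 0\<close>, as all kernel functions vanish at the empty set.
\<close>

lemma kernel_interpolation:
  fixes g :: "'a set \<Rightarrow> real"
  assumes "finite A" "card A \<le> d" "g {} = 0"
  obtains a where "\<And>S. S \<subseteq> A \<Longrightarrow> (\<Sum>R\<in>Pow A. a R * real (card (R \<inter> S)) ^ d) = g S"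
proof -
  define h where "h U = (\<Sum>T\<in>Pow U. (-1) ^ card T * g T)" for U
  define c where "c T = fact (card T) * real (Stirling d (card T))" for T :: "'a set"
  define a where "a R = (\<Sum>T | T \<in> Pow A \<and> R \<subseteq> T. h T / c T * (-1) ^ card R)" for R
  have h_empty: "h {} = 0"
    using assms by (simp add: h_def)
  have "(\<Sum>R\<in>Pow A. a R * real (card (R \<inter> S)) ^ d) = g S" if "S \<subseteq> A" for S
  proof -
    have "(\<Sum>R\<in>Pow A. a R * real (card (R \<inter> S)) ^ d) =
        (\<Sum>R\<in>Pow A. \<Sum>T | T \<in> Pow A \<and> R \<subseteq> T.
          h T / c T * ((-1) ^ card R * real (card (R \<inter> S)) ^ d))"
      unfolding a_def by (simp add: sum_distrib_right mult.assoc)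
    also have "\<dots> = (\<Sum>T\<in>Pow A. \<Sum>R | R \<in> Pow A \<and> R \<subseteq> T.
          h T / c T * ((-1) ^ card R * real (card (R \<inter> S)) ^ d))"
      using \<open>finite A\<close> by (intro sum.swap_restrict) auto
    also have "\<dots> = (\<Sum>T\<in>Pow A. if T \<subseteq> S then (-1) ^ card T * h T else 0)"
    proof (intro sum.cong refl)
      fix T
      assume "T \<in> Pow A"
      then have "T \<subseteq> A" and "finite T" and Pow_T: "{R. R \<in> Pow A \<and> R \<subseteq> T} = Pow T"
        using \<open>finite A\<close> finite_subset by auto
      have "(\<Sum>R | R \<in> Pow A \<and> R \<subseteq> T.
            h T / c T * ((-1) ^ card R * real (card (R \<inter> S)) ^ d)) =
          h T / c T * (if T \<subseteq> S then (-1) ^ card T * c T else 0)"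
        unfolding Pow_T c_def
        by (simp only: sum_distrib_left[symmetric] alternating_sum_card_power[OF \<open>finite T\<close>])
      also have "\<dots> = (if T \<subseteq> S then (-1) ^ card T * h T else 0)"
      proof (cases "T = {}")
        \<comment> \<open>\<open>c {}\<close> vanishes for \<open>d > 0\<close>, and it is \<open>h {} = g {} = 0\<close> that makes the equation hold here.\<close>
        case True
        then show ?thesis
          by (simp add: h_empty)
      next
        case False
        have "card T \<le> d"
          using card_mono[OF \<open>finite A\<close> \<open>T \<subseteq> A\<close>] \<open>card A \<le> d\<close> by linarith
        then have "c T \<noteq> 0"
          using False \<open>finite T\<close> Stirling_pos[of "card T" d] by (simp add: c_def card_gt_0_iff)
        then show ?thesis
          by simp
      qed
      finally show "(\<Sum>R | R \<in> Pow A \<and> R \<subseteq> T.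
            h T / c T * ((-1) ^ card R * real (card (R \<inter> S)) ^ d)) =
          (if T \<subseteq> S then (-1) ^ card T * h T else 0)" .
    qed
    also have "\<dots> = (\<Sum>T\<in>Pow S. (-1) ^ card T * h T)"
      using that \<open>finite A\<close> by (simp add: sum.If_cases, intro sum.cong) auto
    also have "\<dots> = g S"
      using inclusion_exclusion_symmetric[of h g S] finite_subset[OF that \<open>finite A\<close>]
      by (simp add: h_def)
    finally show ?thesis .
  qed
  then show thesis
    by (rule that)
qed

text \<open>
  For a proper subset \<open>R\<close> of \<open>A\<close> the alternating sum of the kernel function cancels already
  because \<open>A \<subseteq> R\<close> fails; for \<open>R = A\<close> it vanishes because no \<open>d\<close>-element set maps onto \<open>A\<close>.
\<close>

lemma kernel_orthogonal_parity:
  assumes "finite A" "d < card A"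
  shows "(\<Sum>S\<in>Pow A. (-1) ^ card S * ((\<Sum>R\<in>Pow A. a R * real (card (R \<inter> S)) ^ d) + b)) = 0"
proof -
  have kernel: "(\<Sum>S\<in>Pow A. (-1) ^ card S * real (card (R \<inter> S)) ^ d) = 0" for R
    using alternating_sum_card_power[OF \<open>finite A\<close>, of R d] \<open>d < card A\<close> by (simp add: Int_commute)
  have const: "(\<Sum>S\<in>Pow A. (-1) ^ card S) = (0::real)"
    using alternating_sum_card_power[OF \<open>finite A\<close>, of A 0] \<open>d < card A\<close>
    by (cases "card A") auto
  have "(\<Sum>S\<in>Pow A. (-1) ^ card S * ((\<Sum>R\<in>Pow A. a R * real (card (R \<inter> S)) ^ d) + b)) =
      (\<Sum>S\<in>Pow A. \<Sum>R\<in>Pow A. a R * ((-1) ^ card S * real (card (R \<inter> S)) ^ d)) +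
      b * (\<Sum>S\<in>Pow A. (-1) ^ card S)"
    by (simp add: algebra_simps sum.distrib sum_distrib_left)
  also have "(\<Sum>S\<in>Pow A. \<Sum>R\<in>Pow A. a R * ((-1) ^ card S * real (card (R \<inter> S)) ^ d)) =
      (\<Sum>R\<in>Pow A. a R * (\<Sum>S\<in>Pow A. (-1) ^ card S * real (card (R \<inter> S)) ^ d))"
    by (subst sum.swap) (simp add: sum_distrib_left)
  finally show ?thesis
    by (simp add: kernel const)
qed

section \<open>Perceptrons on the cube\<close>

definition indicator_point :: "'n set \<Rightarrow> real ^ 'n" where
  "indicator_point S = (\<chi> i. if i \<in> S then 1 else 0)"

lemma bij_betw_indicator_point: "bij_betw indicator_point UNIV cube"
  by (rule bij_betw_byWitness[where f' = "\<lambda>x. {i. x $ i = 1}"])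
     (auto simp: cube_def vec_eq_iff indicator_point_def)

lemma cube_eq: "cube = range indicator_point"
  using bij_betw_indicator_point by (rule bij_betw_imp_surj_on[symmetric])

lemma poly_kernel_indicator_point:
  "poly_kernel d (indicator_point R) (indicator_point S) = real (card (R \<inter> S)) ^ d"
proof -
  have "indicator_point R \<bullet> indicator_point S = (\<Sum>i\<in>UNIV. if i \<in> R \<inter> S then 1 else 0)"
    unfolding inner_vec_def indicator_point_def by (intro sum.cong) auto
  also have "\<dots> = real (card (R \<inter> S))"
    by (simp add: sum.If_cases del: Int_iff)
  finally show ?thesis
    by (simp add: poly_kernel_def)
qed

text \<open>
  The labels occurring as factors in the transfer function are nonzero, so they can be absorbed
  into the free coefficients.
\<close>

lemma realizable_iff:
  fixes f :: "real ^ 'n \<Rightarrow> real"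
  assumes "boolean_function f"
  shows "realizable d f \<longleftrightarrow>
    (\<exists>a b. \<forall>S. threshold ((\<Sum>R\<in>UNIV. a R * real (card (R \<inter> S)) ^ d) + b) =
      f (indicator_point S))"
proof -
  have transfer: "transfer_function d f \<alpha> b (indicator_point S) =
      threshold ((\<Sum>R\<in>UNIV. \<alpha> (indicator_point R) * f (indicator_point R) *
        real (card (R \<inter> S)) ^ d) + b)" for \<alpha> b S
    unfolding transfer_function_def
    by (simp add: sum.reindex_bij_betw[OF bij_betw_indicator_point, symmetric]
        poly_kernel_indicator_point)
  have "f (indicator_point R) \<in> {-1, 1}" for R
    using assms by (simp add: boolean_function_def cube_eq Pi_iff)
  then have nonzero: "f (indicator_point R) \<noteq> 0" for R
    by (metis insertE neg_equal_0_iff_equal singletonD zero_neq_one)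
  have inverse: "the_inv indicator_point (indicator_point R) = R" for R :: "'n set"
    using bij_betw_indicator_point by (intro the_inv_f_f) (auto simp: bij_betw_def)
  show ?thesis
  proof
    assume "realizable d f"
    then obtain \<alpha> b where "\<forall>S. transfer_function d f \<alpha> b (indicator_point S) = f (indicator_point S)"
      by (auto simp: realizable_def cube_eq)
    then show "\<exists>a b. \<forall>S. threshold ((\<Sum>R\<in>UNIV. a R * real (card (R \<inter> S)) ^ d) + b) =
        f (indicator_point S)"
      unfolding transfer
      by (intro exI[of _ "\<lambda>R. \<alpha> (indicator_point R) * f (indicator_point R)"] exI[of _ b])
  next
    assume "\<exists>a b. \<forall>S. threshold ((\<Sum>R\<in>UNIV. a R * real (card (R \<inter> S)) ^ d) + b) =
        f (indicator_point S)"
    then obtain a b where ab: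
      "threshold ((\<Sum>R\<in>UNIV. a R * real (card (R \<inter> S)) ^ d) + b) = f (indicator_point S)" for S
      by blast
    define \<alpha> where "\<alpha> v = a (the_inv indicator_point v) / f v" for v
    have "transfer_function d f \<alpha> b (indicator_point S) = f (indicator_point S)" for S
      by (simp add: transfer \<alpha>_def inverse nonzero ab)
    then show "realizable d f"
      by (auto simp: realizable_def cube_eq)
  qed
qed

lemma boolean_function_realizable:
  fixes f :: "real ^ 'n \<Rightarrow> real"
  assumes "boolean_function f" "CARD('n) \<le> d"
  shows "realizable d f"
proof -
  define b where "b = f (indicator_point {})"
  obtain a where a: "(\<Sum>R\<in>UNIV. a R * real (card (R \<inter> S)) ^ d) = f (indicator_point S) - b" for S
    using kernel_interpolation[of UNIV d "\<lambda>S. f (indicator_point S) - b"] assms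
    by (auto simp: b_def)
  have label: "f (indicator_point S) \<in> {-1, 1}" for S
    using assms by (simp add: boolean_function_def cube_eq Pi_iff)
  have "threshold ((\<Sum>R\<in>UNIV. a R * real (card (R \<inter> S)) ^ d) + b) = f (indicator_point S)"
    for S
    using label[of S] by (auto simp: a threshold_def)
  then show ?thesis
    using assms realizable_iff by blast
qed

definition parity :: "real ^ 'n \<Rightarrow> real" where
  "parity x = (-1) ^ card {i. x $ i = 1}"

lemma parity_indicator_point: "parity (indicator_point S) = (-1) ^ card S"
  by (simp add: parity_def indicator_point_def)

lemma boolean_function_parity: "boolean_function parity"
  by (auto simp: boolean_function_def parity_def minus_one_power_iff)

lemma parity_not_realizable:
  assumes "d < CARD('n)"
  shows "\<not> realizable d (parity :: real ^ 'n \<Rightarrow> real)"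
proof
  assume "realizable d (parity :: real ^ 'n \<Rightarrow> real)"
  then obtain a b where ab:
    "threshold ((\<Sum>R\<in>UNIV. a R * real (card (R \<inter> S)) ^ d) + b) = (-1) ^ card S" for S :: "'n set"
    unfolding realizable_iff[OF boolean_function_parity] parity_indicator_point by blast
  define F where "F S = (\<Sum>R\<in>UNIV. a R * real (card (R \<inter> S)) ^ d) + b" for S :: "'n set"
  have sign: "threshold (F S) = (-1) ^ card S" for S
    using ab by (simp add: F_def)
  have "0 \<le> (-1) ^ card S * F S" for S
    unfolding sign[symmetric] by (simp add: threshold_def)
  moreover have "(\<Sum>S\<in>UNIV. (-1) ^ card S * F S) = 0"
    using kernel_orthogonal_parity[of "UNIV :: 'n set" d a b] assms by (simp add: F_def)
  ultimately have "(-1) ^ card S * F S = 0" for S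
    by (simp add: sum_nonneg_eq_0_iff)
  then have "F S = 0" for S
    by simp
  then show False
    using sign[of "{undefined}"] by (simp add: threshold_def)
qed

theorem corollary5p4:
  shows "(\<forall>f :: real ^ 'n \<Rightarrow> real. boolean_function f \<longrightarrow> realizable CARD('n) f) \<and>
         (\<forall>d :: nat. 1 \<le> d \<and> d < CARD('n) \<longrightarrow>
            (\<exists>f :: real ^ 'n \<Rightarrow> real. boolean_function f \<and> \<not> realizable d f))"
  using boolean_function_realizable boolean_function_parity parity_not_realizable by blast

end
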